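(* Let $d\ge 1$, let $g:\mathbb{N}\to\mathbb{N}$ be monotone and expansive, and let $n_0\in\mathbb{N}$. If $D_0\supsetneq D_1\supsetneq\cdots\supsetneq D_\ell$ is a $(g,n_0)$-controlled strongly monotone descending chain of downwards-closed subsets of $\mathbb{N}^d$, then $\ell\le L_d+1$.
   Context: $\mathbb{N}^d$ is ordered componentwise by $\sqsubseteq$; downwards-closed sets are sets $D$ with $x\in D$, $y\sqsubseteq x\Rightarrow y\in D$. With $\mathbb{N}_\omega=\mathbb{N}\cup\{\omega\}$, the order ideals of $\mathbb{N}^d$ (non-empty directed downwards-closed sets) are the sets $\{x\in\mathbb{N}^d: x\sqsubseteq v\}$, $v\in\mathbb{N}_\omega^d$, identified with $v$. For an ideal $I$: $\omega(I)=\{i: I(i)=\omega\}$, $\mathrm{fin}(I)$ its complement in $\{1,\dots,d\}$, $\dim I=|\omega(I)|$, $\|I\|=\max_{i\in\mathrm{fin}(I)}I(i)$ ($0$ if empty). Each downwards-closed $D$ is uniquely a finite union of pairwise incomparable ideals (canonical decomposition); $I\in D$ means $I$ is in it, and $\|D\|=\max_{I\in D}\|I\|$. An ideal is proper at step $k$ of a descending chain if $I\in D_k$, $I\notin D_{k+1}$. The chain is strongly monotone if whenever $I$ is proper at step $k+1$ there is $I'$ proper at step $k$ with $\dim I\le\dim I'$. It is $(g,n_0)$-controlled (for $g$ monotone and expansive, i.e. $x\le g(x)$) if $\|D_k\|\le g^k(n_0)$ for all $k$. Define $N_0=n_0$, $L_0=0$, and for $0\le i<d$: $N_{i+1}=g^{L_i+1}(n_0)$,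 $L_{i+1}=L_i+\prod_{1\le j\le i+1}(d-j+1)(N_j+1)$. *)

theory Defs
  imports Complex_Main "HOL-Library.Extended_Nat" "HOL-Library.Cardinality"
begin

text \<open>
  \<open>\<nat>\<^sup>d\<close> is the type \<open>'n \<Rightarrow> nat\<close> for a finite index type \<open>'n\<close> with \<open>CARD('n) = d\<close>, and
  \<open>\<nat>\<^sub>\<omega>\<^sup>d\<close> is \<open>'n \<Rightarrow> enat\<close> with \<open>\<omega> = \<infinity>\<close>; the order \<open>\<le>\<close> on functions is the
  componentwise one. An order ideal is represented by the vector \<open>v\<close> with which it is
  identified; \<open>order_ideal_iff\<close> below justifies this.
\<close>

definition downward_closed :: "'a::order set \<Rightarrow> bool" where
  "downward_closed D \<longleftrightarrow> (\<forall>x\<in>D. \<forall>y\<le>x. y \<in> D)"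

definition order_ideal :: "'a::order set \<Rightarrow> bool" where
  "order_ideal I \<longleftrightarrow>
     I \<noteq> {} \<and> downward_closed I \<and> (\<forall>x\<in>I. \<forall>y\<in>I. \<exists>z\<in>I. x \<le> z \<and> y \<le> z)"

definition ideal_of :: "('n \<Rightarrow> enat) \<Rightarrow> ('n \<Rightarrow> nat) set" where
  "ideal_of v = {x. (\<lambda>i. enat (x i)) \<le> v}"

definition omega_set :: "('n \<Rightarrow> enat) \<Rightarrow> 'n set" where
  "omega_set v = {i. v i = \<infinity>}"

definition fin_set :: "('n \<Rightarrow> enat) \<Rightarrow> 'n set" where
  "fin_set v = - omega_set v"

definition ideal_dim :: "('n::finite \<Rightarrow> enat) \<Rightarrow> nat" where
  "ideal_dim v = card (omega_set v)"

definition ideal_norm :: "('n::finite \<Rightarrow> enat) \<Rightarrow> nat" where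
  "ideal_norm v = Max (insert 0 ((\<lambda>i. the_enat (v i)) ` fin_set v))"

definition is_decomposition :: "('n \<Rightarrow> nat) set \<Rightarrow> ('n \<Rightarrow> enat) set \<Rightarrow> bool" where
  "is_decomposition D F \<longleftrightarrow>
     finite F \<and>
     (\<forall>v\<in>F. \<forall>w\<in>F. v \<noteq> w \<longrightarrow> \<not> ideal_of v \<subseteq> ideal_of w) \<and>
     D = (\<Union>v\<in>F. ideal_of v)"

definition decomposition :: "('n::finite \<Rightarrow> nat) set \<Rightarrow> ('n \<Rightarrow> enat) set" where
  "decomposition D = (THE F. is_decomposition D F)"

text \<open>The empty set has the empty decomposition and gets norm \<open>0\<close>.\<close>

definition set_norm :: "('n::finite \<Rightarrow> nat) set \<Rightarrow> nat" where
  "set_norm D = Max (insert 0 (ideal_norm ` decomposition D))"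

text \<open>
  A chain \<open>D\<^sub>0, \<dots>, D\<^sub>l\<close> is a sequence of which only the entries up to index \<open>l\<close> matter.
  Ideals are proper only at steps \<open>k < l\<close>, since \<open>D\<^sub>k\<^sub>+\<^sub>1\<close> has to exist.
\<close>

definition descending_chain :: "(nat \<Rightarrow> ('n::finite \<Rightarrow> nat) set) \<Rightarrow> nat \<Rightarrow> bool" where
  "descending_chain D l \<longleftrightarrow>
     (\<forall>k\<le>l. downward_closed (D k)) \<and> (\<forall>k<l. D (Suc k) \<subset> D k)"

definition proper_at ::
  "(nat \<Rightarrow> ('n::finite \<Rightarrow> nat) set) \<Rightarrow> nat \<Rightarrow> nat \<Rightarrow> ('n \<Rightarrow> enat) \<Rightarrow> bool" where
  "proper_at D l k I \<longleftrightarrow>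
     k < l \<and> I \<in> decomposition (D k) \<and> I \<notin> decomposition (D (Suc k))"

definition strongly_monotone :: "(nat \<Rightarrow> ('n::finite \<Rightarrow> nat) set) \<Rightarrow> nat \<Rightarrow> bool" where
  "strongly_monotone D l \<longleftrightarrow>
     (\<forall>k I. proper_at D l (Suc k) I \<longrightarrow>
        (\<exists>I'. proper_at D l k I' \<and> ideal_dim I \<le> ideal_dim I'))"

definition controlled ::
  "(nat \<Rightarrow> nat) \<Rightarrow> nat \<Rightarrow> (nat \<Rightarrow> ('n::finite \<Rightarrow> nat) set) \<Rightarrow> nat \<Rightarrow> bool" where
  "controlled g n0 D l \<longleftrightarrow> (\<forall>k\<le>l. set_norm (D k) \<le> (g ^^ k) n0)"

text \<open>
  The values are meaningful only for indices up to \<open>d\<close>; in that range the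
  subtraction \<open>d - j\<close> does not truncate.
\<close>

function N_seq :: "nat \<Rightarrow> (nat \<Rightarrow> nat) \<Rightarrow> nat \<Rightarrow> nat \<Rightarrow> nat"
  and L_seq :: "nat \<Rightarrow> (nat \<Rightarrow> nat) \<Rightarrow> nat \<Rightarrow> nat \<Rightarrow> nat" where
  "N_seq d g n0 0 = n0"
| "N_seq d g n0 (Suc i) = (g ^^ (L_seq d g n0 i + 1)) n0"
| "L_seq d g n0 0 = 0"
| "L_seq d g n0 (Suc i) =
     L_seq d g n0 i + (\<Prod>j\<in>{1..Suc i}. (d - j + 1) * (N_seq d g n0 j + 1))"
  by pat_completeness auto
termination
  by (relation "measure (case_sum (\<lambda>(_, _, _, i). 2 * i) (\<lambda>(_, _, _, i). 2 * i + 1))") auto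


subsection \<open>Well-definedness\<close>

lemma ideal_of_subset_iff: "ideal_of v \<subseteq> ideal_of w \<longleftrightarrow> v \<le> w"
proof
  assume sub: "ideal_of v \<subseteq> ideal_of w"
  show "v \<le> w"
  proof (rule le_funI, rule ccontr)
    fix i assume "\<not> v i \<le> w i"
    then have lt: "w i < v i" by simp
    then obtain m where m: "w i = enat m" by (cases "w i") auto
    define x where "x = (\<lambda>j. if j = i then Suc m else 0)"
    have "enat (Suc m) \<le> v i"
      using lt m by (metis Suc_ile_eq)
    then have "x \<in> ideal_of v"
      by (auto simp: ideal_of_def x_def le_fun_def zero_enat_def[symmetric])
    with sub have "x \<in> ideal_of w" by blast
    then have "enat (Suc m) \<le> w i"
      unfolding ideal_of_def x_def le_fun_def by (auto dest: spec[of _ i])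
    with m show False by simp
  qed
next
  assume "v \<le> w"
  then show "ideal_of v \<subseteq> ideal_of w"
    by (auto simp: ideal_of_def intro: order_trans)
qed

lemma order_ideal_ideal_of: "order_ideal (ideal_of v)"
proof -
  have "(\<lambda>_. 0) \<in> ideal_of v"
    by (simp add: ideal_of_def le_fun_def zero_enat_def[symmetric])
  moreover have "downward_closed (ideal_of v)"
    unfolding downward_closed_def
  proof (intro ballI allI impI)
    fix x y assume "x \<in> ideal_of v" and le: "y \<le> x"
    then have x: "\<And>i. enat (x i) \<le> v i" by (simp add: ideal_of_def le_fun_def)
    have "enat (y i) \<le> v i" for i
      by (rule order_trans[OF _ x]) (use le in \<open>simp add: le_fun_def\<close>)
    then show "y \<in> ideal_of v" by (simp add: ideal_of_def le_fun_def)
  qed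
  moreover have "\<exists>z\<in>ideal_of v. x \<le> z \<and> y \<le> z" if "x \<in> ideal_of v" "y \<in> ideal_of v" for x y
    using that by (intro bexI[of _ "\<lambda>i. max (x i) (y i)"]) (auto simp: ideal_of_def le_fun_def max_def)
  ultimately show ?thesis
    unfolding order_ideal_def by blast
qed

lemma directed_finite_bound:
  assumes "order_ideal I" "finite S" "S \<subseteq> I"
  shows "\<exists>z\<in>I. \<forall>x\<in>S. x \<le> z"
  using assms(2,3)
proof (induction S rule: finite_induct)
  case empty
  then show ?case using assms(1) by (auto simp: order_ideal_def)
next
  case (insert a S)
  then obtain z where z: "z \<in> I" "\<forall>x\<in>S. x \<le> z" by auto
  with insert.prems assms(1) obtain z' where "z' \<in> I" "a \<le> z'" "z \<le> z'"
    unfolding order_ideal_def by blast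
  with z show ?case by (metis insert_iff order_trans)
qed

lemma order_ideal_iff:
  fixes I :: "('n::finite \<Rightarrow> nat) set"
  shows "order_ideal I \<longleftrightarrow> (\<exists>v. I = ideal_of v)"
proof
  assume I: "order_ideal I"
  define v where "v = (\<lambda>i. SUP x\<in>I. enat (x i))"
  have "x \<in> I" if x: "x \<in> ideal_of v" for x
  proof -
    have "\<exists>y\<in>I. x i \<le> y i" for i
    proof (rule ccontr)
      assume "\<not> ?thesis"
      then have lt: "y i < x i" if "y \<in> I" for y using that by auto
      have "I \<noteq> {}" using I by (simp add: order_ideal_def)
      with lt have pos: "x i > 0" by fastforce
      have "v i \<le> enat (x i - 1)"
        unfolding v_def by (rule SUP_least) (use lt in fastforce)
      moreover have "enat (x i) \<le> v i" using x by (auto simp: ideal_of_def le_fun_def)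
      ultimately have "enat (x i) \<le> enat (x i - 1)" by (rule order_trans[rotated])
      with pos show False by simp
    qed
    then obtain y where y: "\<And>i. y i \<in> I" "\<And>i. x i \<le> y i i" by metis
    obtain z where "z \<in> I" "\<forall>w\<in>range y. w \<le> z"
      using directed_finite_bound[OF I, of "range y"] y by auto
    moreover have "x \<le> z"
    proof (rule le_funI)
      fix i
      have "y i \<le> z" using calculation by blast
      then have "y i i \<le> z i" by (rule le_funD)
      with y(2)[of i] show "x i \<le> z i" by (rule order_trans)
    qed
    ultimately show ?thesis using I by (auto simp: order_ideal_def downward_closed_def)
  qed
  moreover have "x \<in> ideal_of v" if "x \<in> I" for x
    using that by (auto simp: ideal_of_def v_def le_fun_def intro: SUP_upper)
  ultimately show "\<exists>v. I = ideal_of v" by blast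
qed (auto simp: order_ideal_ideal_of)

lemma enat_mono_subseq:
  fixes f :: "nat \<Rightarrow> enat"
  shows "\<exists>r :: nat \<Rightarrow> nat. strict_mono r \<and> (\<forall>m n. m \<le> n \<longrightarrow> f (r m) \<le> f (r n))"
proof -
  obtain r where r: "strict_mono (r :: nat \<Rightarrow> nat)" "monoseq (\<lambda>n. f (r n))"
    using seq_monosub by blast
  from r(2) show ?thesis unfolding monoseq_def
  proof
    assume "\<forall>m. \<forall>n\<ge>m. f (r m) \<le> f (r n)"
    with r(1) show ?thesis by blast
  next
    assume dec: "\<forall>m. \<forall>n\<ge>m. f (r n) \<le> f (r m)"
    define a where "a = (LEAST a. \<exists>n. a = f (r n))"
    have "\<exists>n. a = f (r n)" unfolding a_def by (rule LeastI_ex) blast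
    then obtain n0 where n0: "a = f (r n0)" by blast
    have low: "a \<le> f (r n)" for n unfolding a_def by (rule Least_le) blast
    have "f (r n) = a" if "n \<ge> n0" for n
      using dec that n0 low by (metis antisym)
    then have "\<forall>m n. m \<le> n \<longrightarrow> f (r (n0 + m)) \<le> f (r (n0 + n))" by simp
    moreover have "strict_mono (\<lambda>n. r (n0 + n))"
      using r(1) by (simp add: strict_mono_def)
    ultimately show ?thesis by (intro exI[of _ "\<lambda>n. r (n0 + n)"]) simp
  qed
qed

lemma enat_vec_mono_subseq:
  fixes f :: "nat \<Rightarrow> ('n::finite \<Rightarrow> enat)"
  shows "\<exists>r :: nat \<Rightarrow> nat. strict_mono r \<and> (\<forall>m n. m \<le> n \<longrightarrow> f (r m) \<le> f (r n))"
proof -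
  have "\<exists>r :: nat \<Rightarrow> nat. strict_mono r \<and> (\<forall>i\<in>S. \<forall>m n. m \<le> n \<longrightarrow> f (r m) i \<le> f (r n) i)" if "finite S" for S
    using that
  proof (induction S rule: finite_induct)
    case empty
    have "strict_mono (id :: nat \<Rightarrow> nat)" by (simp add: strict_mono_def)
    then show ?case by blast
  next
    case (insert a S)
    then obtain r where r: "strict_mono (r :: nat \<Rightarrow> nat)"
      "\<forall>i\<in>S. \<forall>m n. m \<le> n \<longrightarrow> f (r m) i \<le> f (r n) i" by blast
    obtain s where s: "strict_mono (s :: nat \<Rightarrow> nat)"
      "\<forall>m n. m \<le> n \<longrightarrow> f (r (s m)) a \<le> f (r (s n)) a"
      using enat_mono_subseq[of "\<lambda>n. f (r n) a"] by blast
    have "strict_mono (\<lambda>n. r (s n))" using r(1) s(1) by (simp add: strict_mono_def)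
    moreover have "s m \<le> s n" if "m \<le> n" for m n
      using s(1) that by (simp add: strict_mono_less_eq)
    ultimately show ?case using r(2) s(2) by (intro exI[of _ "\<lambda>n. r (s n)"]) auto
  qed
  from this[of UNIV] show ?thesis by (simp add: le_fun_def) blast
qed

lemma finite_enat_vec_antichain:
  fixes A :: "('n::finite \<Rightarrow> enat) set"
  assumes "\<forall>v\<in>A. \<forall>w\<in>A. v \<noteq> w \<longrightarrow> \<not> v \<le> w"
  shows "finite A"
proof (rule ccontr)
  assume "infinite A"
  then obtain f :: "nat \<Rightarrow> _" where f: "inj f" "range f \<subseteq> A"
    using infinite_countable_subset by blast
  obtain r where r: "strict_mono (r :: nat \<Rightarrow> nat)" "\<forall>m n. m \<le> n \<longrightarrow> f (r m) \<le> f (r n)"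
    using enat_vec_mono_subseq by blast
  have "r 0 \<noteq> r 1" using r(1) by (metis strict_mono_eq zero_neq_one)
  then have "f (r 0) \<noteq> f (r 1)" using f(1) by (auto dest: injD)
  moreover have "f (r 0) \<le> f (r 1)" using r(2) by simp
  ultimately show False using assms f(2) by blast
qed

lemma ex_maximal_ideal:
  fixes D :: "('n::finite \<Rightarrow> nat) set"
  assumes v: "ideal_of v \<subseteq> D"
  shows "\<exists>w\<ge>v. ideal_of w \<subseteq> D \<and> (\<forall>u\<ge>w. ideal_of u \<subseteq> D \<longrightarrow> u = w)"
proof -
  define P where "P = {w. v \<le> w \<and> ideal_of w \<subseteq> D}"
  have "\<exists>m\<in>P. \<forall>a\<in>P. m \<le> a \<longrightarrow> a = m"
  proof (rule predicate_Zorn[where P = "(\<le>)"])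
    show "partial_order_on P (relation_of (\<le>) P)"
      by (auto simp: partial_order_on_def preorder_on_def refl_on_def trans_def antisym_def
          relation_of_def)
  next
    fix C assume "C \<in> Chains (relation_of (\<le>) P)"
    then have C: "C \<subseteq> P" "\<And>x y. x \<in> C \<Longrightarrow> y \<in> C \<Longrightarrow> x \<le> y \<or> y \<le> x"
      by (auto simp: Chains_def relation_of_def)
    show "\<exists>u\<in>P. \<forall>a\<in>C. a \<le> u"
    proof (cases "C = {}")
      case True
      have "v \<in> P" using v by (simp add: P_def)
      with True show ?thesis by blast
    next
      case False
      define u where "u = (\<lambda>i. SUP w\<in>C. w i)"
      have up: "w \<le> u" if "w \<in> C" for w
        using that by (auto simp: u_def le_fun_def intro: SUP_upper)
      have "x \<in> D" if x: "x \<in> ideal_of u" for x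
      proof -
        have "\<exists>w\<in>C. enat (x i) \<le> w i" for i
        proof (rule ccontr)
          assume "\<not> ?thesis"
          then have lt: "w i < enat (x i)" if "w \<in> C" for w using that by auto
          with False have pos: "x i > 0"
            by (metis all_not_in_conv gr0I not_less_zero zero_enat_def)
          have "w i \<le> enat (x i - 1)" if "w \<in> C" for w
            using lt[OF that] by (cases "w i") auto
          then have "u i \<le> enat (x i - 1)" unfolding u_def by (rule SUP_least)
          moreover have "enat (x i) \<le> u i" using x by (auto simp: ideal_of_def le_fun_def)
          ultimately have "enat (x i) \<le> enat (x i - 1)" by (rule order_trans[rotated])
          with pos show False by simp
        qed
        then obtain y where y: "\<And>i. y i \<in> C" "\<And>i. enat (x i) \<le> y i i" by metis
        have "\<exists>z\<in>C. \<forall>w\<in>S. w \<le> z" if "finite S" "S \<subseteq> C" for S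
          using that
        proof (induction S rule: finite_induct)
          case empty
          then show ?case using False by blast
        next
          case (insert a S)
          then obtain z where z: "z \<in> C" "\<forall>w\<in>S. w \<le> z" by auto
          have a: "a \<in> C" using insert.prems by simp
          from C(2)[OF a z(1)] show ?case
          proof
            assume "a \<le> z"
            with z show ?case by blast
          next
            assume "z \<le> a"
            with z a show ?case by (metis insert_iff order_trans order_refl)
          qed
        qed
        from this[of "range y"] y obtain z where z: "z \<in> C" "\<And>i. y i \<le> z" by auto
        have "x \<in> ideal_of z"
          unfolding ideal_of_def mem_Collect_eq
          using y(2) z(2) by (meson le_fun_def order_trans)
        with z(1) C(1) show ?thesis by (auto simp: P_def)
      qed
      moreover have "v \<le> u"
      proof -
        obtain w where "w \<in> C" using False by blast
        with C(1) up[of w] show ?thesis unfolding P_def by (blast intro: order_trans[of v w u])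
      qed
      ultimately have "u \<in> P" by (auto simp: P_def)
      with up show ?thesis by blast
    qed
  qed
  then obtain m where m: "v \<le> m" "ideal_of m \<subseteq> D"
    "\<And>a. v \<le> a \<Longrightarrow> ideal_of a \<subseteq> D \<Longrightarrow> m \<le> a \<Longrightarrow> a = m"
    unfolding P_def by blast
  then have "\<forall>u\<ge>m. ideal_of u \<subseteq> D \<longrightarrow> u = m" by (meson order_trans)
  with m show ?thesis by blast
qed

lemma order_ideal_subset_Union:
  assumes "finite F" "ideal_of v \<subseteq> (\<Union>w\<in>F. ideal_of w)"
  shows "\<exists>w\<in>F. v \<le> w"
proof (rule ccontr)
  assume "\<not> ?thesis"
  then have "\<forall>w\<in>F. \<exists>x. x \<in> ideal_of v \<and> x \<notin> ideal_of w"
    by (metis ideal_of_subset_iff subsetI)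
  then obtain y where y: "\<forall>w\<in>F. y w \<in> ideal_of v \<and> y w \<notin> ideal_of w" by metis
  obtain z where z: "z \<in> ideal_of v" "\<forall>x\<in>y ` F. x \<le> z"
    using directed_finite_bound[OF order_ideal_ideal_of, of "y ` F" v] assms(1) y by auto
  then obtain w where w: "w \<in> F" "z \<in> ideal_of w" using assms(2) by blast
  then have "y w \<in> ideal_of w"
    using z(2) order_ideal_ideal_of[of w] by (auto simp: order_ideal_def downward_closed_def)
  with y w show False by blast
qed

lemma ex1_decomposition:
  fixes D :: "('n::finite \<Rightarrow> nat) set"
  assumes D: "downward_closed D"
  shows "\<exists>!F. is_decomposition D F"
proof (rule ex_ex1I)
  define M where "M = {w. ideal_of w \<subseteq> D \<and> (\<forall>u\<ge>w. ideal_of u \<subseteq> D \<longrightarrow> u = w)}"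
  have anti: "\<forall>v\<in>M. \<forall>w\<in>M. v \<noteq> w \<longrightarrow> \<not> v \<le> w" by (auto simp: M_def)
  have "x \<in> (\<Union>v\<in>M. ideal_of v)" if x: "x \<in> D" for x
  proof -
    have "ideal_of (\<lambda>i. enat (x i)) \<subseteq> D"
      using D x by (auto simp: downward_closed_def ideal_of_def le_fun_def)
    from ex_maximal_ideal[OF this] obtain w where "(\<lambda>i. enat (x i)) \<le> w" "w \<in> M"
      by (auto simp: M_def)
    then show ?thesis by (auto simp: ideal_of_def)
  qed
  then have "D = (\<Union>v\<in>M. ideal_of v)" by (auto simp: M_def)
  with anti finite_enat_vec_antichain[OF anti] show "\<exists>F. is_decomposition D F"
    by (auto simp: is_decomposition_def ideal_of_subset_iff)
next
  have "F \<subseteq> G" if F: "is_decomposition D F" and G: "is_decomposition D G" for F G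
  proof
    fix v assume v: "v \<in> F"
    have "\<exists>w\<in>G. v \<le> w"
      by (rule order_ideal_subset_Union) (use v F G in \<open>auto simp: is_decomposition_def\<close>)
    then obtain w where w: "w \<in> G" "v \<le> w" by blast
    have "\<exists>u\<in>F. w \<le> u"
      by (rule order_ideal_subset_Union) (use w F G in \<open>auto simp: is_decomposition_def\<close>)
    then obtain u where u: "u \<in> F" "w \<le> u" by blast
    with v w F have "v = u"
      unfolding is_decomposition_def ideal_of_subset_iff by (meson order_trans)
    with w u show "v \<in> G" by simp
  qed
  then show "F = G" if "is_decomposition D F" "is_decomposition D G" for F G
    using that by blast
qed

end

theory Submission
  imports Defs
begin

text \<open>
  Call an ideal thin if its finite coordinates can be enumerated in such a way that the \<open>j\<close>-th
  one is at most \<open>N\<^sub>j\<close>; at most \<open>\<Prod>\<^bsub>1\<le>j\<le>m\<^esub> (d - j + 1) (N\<^sub>j + 1)\<close> thin ideals have exactly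
  \<open>m\<close> finite coordinates. An ideal is proper at no more than one step, and by strong
  monotonicity an ideal with \<open>i\<close> finite coordinates that is proper at step \<open>k\<close> yields, at each of
  the steps \<open>0, \<dots>, k\<close>, a proper ideal with at most \<open>i\<close> finite coordinates. If all these are thin,
  counting them gives \<open>k \<le> L\<^sub>i\<close>. All ideals of all \<open>D\<^sub>k\<close> are indeed thin, by induction on \<open>k\<close>: an
  ideal that is new in \<open>D\<^sub>k\<^sub>+\<^sub>1\<close> lies below some \<open>J\<close> proper at step \<open>k\<close>, with \<open>i\<close> finite
  coordinates say; on these it is bounded by \<open>J\<close>, and its other finite coordinates are at most
  \<open>g\<^sup>k\<^sup>+\<^sup>1(n\<^sub>0) \<le> N\<^sub>i\<^sub>+\<^sub>1\<close> because \<open>k \<le> L\<^sub>i\<close>.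
\<close>

subsection \<open>Canonical decompositions\<close>

lemma is_decomposition_decomposition:
  "downward_closed D \<Longrightarrow> is_decomposition D (decomposition D)"
  unfolding decomposition_def by (rule theI') (rule ex1_decomposition)

lemma decomposition_Union:
  "downward_closed D \<Longrightarrow> D = (\<Union>v\<in>decomposition D. ideal_of v)"
  using is_decomposition_decomposition[of D] by (simp add: is_decomposition_def)

lemma finite_decomposition: "downward_closed D \<Longrightarrow> finite (decomposition D)"
  using is_decomposition_decomposition[of D] by (simp add: is_decomposition_def)

lemma decomposition_antichain:
  "downward_closed D \<Longrightarrow> v \<in> decomposition D \<Longrightarrow> w \<in> decomposition D \<Longrightarrow> v \<le> w \<Longrightarrow> v = w"
  using is_decomposition_decomposition[of D]
  unfolding is_decomposition_def ideal_of_subset_iff by blast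

lemma decomposition_subset:
  "downward_closed D \<Longrightarrow> v \<in> decomposition D \<Longrightarrow> ideal_of v \<subseteq> D"
  using decomposition_Union[of D] by blast

lemma ideal_subset_decomposition:
  assumes "downward_closed D" "ideal_of v \<subseteq> D"
  obtains w where "w \<in> decomposition D" "v \<le> w"
  using order_ideal_subset_Union[OF finite_decomposition[OF assms(1)], of v]
    assms(2) decomposition_Union[OF assms(1)] by auto

lemma le_ideal_norm: "v i = enat a \<Longrightarrow> a \<le> ideal_norm v"
  unfolding ideal_norm_def
  by (rule Max_ge) (auto simp: fin_set_def omega_set_def intro!: image_eqI[of _ _ i])

lemma ideal_norm_le_set_norm:
  "downward_closed D \<Longrightarrow> v \<in> decomposition D \<Longrightarrow> ideal_norm v \<le> set_norm D"
  unfolding set_norm_def by (rule Max_ge) (auto simp: finite_decomposition)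

lemma card_fin_set: "card (fin_set (v :: 'n::finite \<Rightarrow> enat)) = CARD('n) - ideal_dim v"
  by (simp add: fin_set_def ideal_dim_def Compl_eq_Diff_UNIV card_Diff_subset)


subsection \<open>Thin ideals\<close>

text \<open>Fixing the finite coordinates one at a time makes the number of choices at stage
  \<open>j\<close> match the \<open>j\<close>-th factor of the product in
  \<open>L_seq\<close>.\<close>

fun thin :: "(nat \<Rightarrow> nat) \<Rightarrow> nat \<Rightarrow> ('n \<Rightarrow> enat) set" where
  "thin N 0 = {\<lambda>_. \<infinity>}"
| "thin N (Suc m) =
     (\<Union>v\<in>thin N m. \<Union>i\<in>omega_set v. (\<lambda>a. v(i := enat a)) ` {..N (Suc m)})"

lemma thin_SucI:
  assumes "v \<in> thin N m" "v i = \<infinity>" "a \<le> N (Suc m)"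
  shows "v(i := enat a) \<in> thin N (Suc m)"
  unfolding thin.simps
proof (intro UN_I)
  show "i \<in> omega_set v" using assms(2) by (simp add: omega_set_def)
qed (use assms in auto)

lemma finite_thin: "finite (thin N m :: ('n::finite \<Rightarrow> enat) set)"
  by (induction m) auto

lemma card_fin_set_thin:
  "(v :: 'n::finite \<Rightarrow> enat) \<in> thin N m \<Longrightarrow> card (fin_set v) = m"
proof (induction m arbitrary: v)
  case 0
  then show ?case by (simp add: fin_set_def omega_set_def)
next
  case (Suc m)
  then obtain u i a where u: "u \<in> thin N m" "i \<in> omega_set u" "v = u(i := enat a)"
    by auto
  then have "fin_set v = insert i (fin_set u)" "i \<notin> fin_set u"
    by (auto simp: fin_set_def omega_set_def)
  with Suc.IH[OF u(1)] show ?case by simp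
qed

text \<open>Stage \<open>j\<close> picks one of the \<open>d - j + 1\<close> coordinates that are
  still infinite and one of \<open>N j + 1\<close> values. Different orders may give the same
  vector, hence only an upper bound.\<close>

lemma card_thin:
  "card (thin N m :: ('n::finite \<Rightarrow> enat) set) \<le> (\<Prod>j\<in>{1..m}. (CARD('n) - j + 1) * (N j + 1))"
proof (induction m)
  case 0
  then show ?case by simp
next
  case (Suc m)
  let ?B = "(CARD('n) - Suc m + 1) * (N (Suc m) + 1)"
  have ext: "card (\<Union>i\<in>omega_set v. (\<lambda>a. v(i := enat a)) ` {..N (Suc m)}) \<le> ?B"
    if v: "v \<in> thin N m" for v :: "'n \<Rightarrow> enat"
  proof -
    have "card (\<Union>i\<in>omega_set v. (\<lambda>a. v(i := enat a)) ` {..N (Suc m)})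
        \<le> (\<Sum>i\<in>omega_set v. card ((\<lambda>a. v(i := enat a)) ` {..N (Suc m)}))"
      by (rule card_UN_le) simp
    also have "\<dots> \<le> (\<Sum>i\<in>omega_set v. N (Suc m) + 1)"
      by (rule sum_mono) (metis card_atMost card_image_le finite_atMost Suc_eq_plus1)
    also have "\<dots> = card (omega_set v) * (N (Suc m) + 1)" by simp
    also have "\<dots> \<le> ?B"
    proof (rule mult_right_mono)
      \<comment> \<open>For \<open>m = CARD('n)\<close> the subtraction truncates and the right side
        is 1, but then \<open>omega_set v\<close> is empty.\<close>
      have "card (omega_set v) \<le> CARD('n)" by (rule card_mono) auto
      then show "card (omega_set v) \<le> CARD('n) - Suc m + 1"
        using card_fin_set_thin[OF v] card_fin_set[of v] by (simp add: ideal_dim_def)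
    qed simp
    finally show ?thesis .
  qed
  have "card (thin N (Suc m) :: ('n \<Rightarrow> enat) set) \<le> (\<Sum>v\<in>thin N m.
      card (\<Union>i\<in>omega_set v. (\<lambda>a. (v :: 'n \<Rightarrow> enat)(i := enat a)) ` {..N (Suc m)}))"
    unfolding thin.simps by (rule card_UN_le) (rule finite_thin)
  also have "\<dots> \<le> (\<Sum>v\<in>(thin N m :: ('n \<Rightarrow> enat) set). ?B)"
    by (rule sum_mono) (rule ext)
  also have "\<dots> = card (thin N m :: ('n \<Rightarrow> enat) set) * ?B" by simp
  also have "\<dots> \<le> (\<Prod>j\<in>{1..m}. (CARD('n) - j + 1) * (N j + 1)) * ?B"
    by (rule mult_right_mono) (use Suc.IH in simp_all)
  also have "\<dots> = (\<Prod>j\<in>{1..Suc m}. (CARD('n) - j + 1) * (N j + 1))"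
    by simp
  finally show ?case .
qed

text \<open>The enumeration that makes \<open>v\<close> thin also serves \<open>w\<close>. The
  induction resets the coordinate fixed last to infinity and fixes it again at its smaller
  value.\<close>

lemma thin_le:
  "v \<in> thin N m \<Longrightarrow> w \<le> v \<Longrightarrow> omega_set w = omega_set v \<Longrightarrow> w \<in> thin N m"
proof (induction m arbitrary: v w)
  case 0
  then have "w i = \<infinity>" for i by (auto simp: omega_set_def)
  then show ?case by auto
next
  case (Suc m)
  then obtain u i a where u: "u \<in> thin N m" "u i = \<infinity>" "v = u(i := enat a)" "a \<le> N (Suc m)"
    by (auto simp: omega_set_def)
  have "w i \<le> enat a" using Suc.prems(2) u(3) by (metis fun_upd_same le_funD)
  then obtain b where b: "w i = enat b" "b \<le> a" by (cases "w i") auto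
  have "w(i := \<infinity>) \<in> thin N m"
  proof (rule Suc.IH[OF u(1)])
    show "w(i := \<infinity>) \<le> u"
      using Suc.prems(2) u by (auto simp: le_fun_def split: if_splits)
    show "omega_set (w(i := \<infinity>)) = omega_set u"
      using Suc.prems(3) u unfolding omega_set_def set_eq_iff mem_Collect_eq
      by (metis fun_upd_apply)
  qed
  from thin_SucI[OF this, of i b] b u(4) show ?case by (simp add: fun_upd_idem)
qed

text \<open>The coordinates in \<open>S\<close> are appended to the enumeration in any order: the
  bound \<open>N (Suc m)\<close> of the first new position is also below the bounds of all later
  ones.\<close>

lemma thin_extend:
  assumes N: "mono N" and v: "v \<in> thin N m"
  shows "finite S \<Longrightarrow> S \<subseteq> omega_set v \<Longrightarrow> \<forall>i\<in>S. a i \<le> N (Suc m) \<Longrightarrow>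
    (\<lambda>i. if i \<in> S then enat (a i) else v i) \<in> thin N (m + card S)"
proof (induction S rule: finite_induct)
  case empty
  then show ?case using v by simp
next
  case (insert x S)
  let ?w = "\<lambda>i. if i \<in> S then enat (a i) else v i"
  have "?w(x := enat (a x)) \<in> thin N (Suc (m + card S))"
  proof (rule thin_SucI)
    show "?w \<in> thin N (m + card S)" using insert by auto
    show "?w x = \<infinity>" using insert by (auto simp: omega_set_def)
    have "a x \<le> N (Suc m)" using insert.prems by simp
    also have "\<dots> \<le> N (Suc (m + card S))" using N by (rule monoD) simp
    finally show "a x \<le> N (Suc (m + card S))" .
  qed
  moreover have "?w(x := enat (a x)) = (\<lambda>i. if i \<in> insert x S then enat (a i) else v i)"
    by auto
  ultimately show ?case using insert.hyps by simp
qed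

lemma thin_below:
  fixes v w :: "'n::finite \<Rightarrow> enat"
  assumes N: "mono N" and v: "v \<in> thin N m" and le: "w \<le> v"
    and bound: "\<And>i a. v i = \<infinity> \<Longrightarrow> w i = enat a \<Longrightarrow> a \<le> N (Suc m)"
  shows "w \<in> thin N (card (fin_set w))"
proof -
  define S where "S = omega_set v - omega_set w"
  \<comment> \<open>\<open>u\<close> has the same infinite coordinates as \<open>v\<close>, so
    \<open>thin_le\<close> applies to it; the coordinates in \<open>S\<close> are then fixed by
    \<open>thin_extend\<close>.\<close>
  define u where "u = (\<lambda>i. if i \<in> S then \<infinity> else w i)"
  have "v i = \<infinity>" if "w i = \<infinity>" for i
    using le_funD[OF le, of i] that by simp
  then have "omega_set w \<subseteq> omega_set v" by (auto simp: omega_set_def)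
  then have "omega_set u = omega_set v" by (auto simp: S_def u_def omega_set_def)
  moreover have "u \<le> v"
    using le by (auto simp: le_fun_def u_def S_def omega_set_def)
  ultimately have u: "u \<in> thin N m" using v by (blast intro: thin_le)
  have "w = (\<lambda>i. if i \<in> S then enat (the_enat (w i)) else u i)"
    by (rule ext) (auto simp: u_def S_def omega_set_def)
  moreover have "(\<lambda>i. if i \<in> S then enat (the_enat (w i)) else u i) \<in> thin N (m + card S)"
  proof (rule thin_extend[OF N u])
    show "\<forall>i\<in>S. the_enat (w i) \<le> N (Suc m)"
      using bound by (force simp: S_def omega_set_def)
  qed (auto simp: u_def S_def omega_set_def)
  ultimately have "w \<in> thin N (m + card S)" by simp
  with card_fin_set_thin[OF this] show ?thesis by simp
qed


subsection \<open>The bounds \<open>N\<^sub>i\<close> and \<open>L\<^sub>i\<close>\<close>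

lemma funpow_expansive_mono:
  fixes g :: "nat \<Rightarrow> nat"
  assumes "\<And>x. x \<le> g x"
  shows "m \<le> n \<Longrightarrow> (g ^^ m) x \<le> (g ^^ n) x"
proof (induction n rule: dec_induct)
  case (step n)
  then show ?case using assms[of "(g ^^ n) x"] by simp
qed simp

lemma mono_N_seq:
  assumes "\<And>x. x \<le> g x"
  shows "mono (N_seq d g n0)"
proof (rule iffD2[OF mono_iff_le_Suc], rule allI)
  fix i
  show "N_seq d g n0 i \<le> N_seq d g n0 (Suc i)"
  proof (cases i)
    case 0
    then show ?thesis using funpow_expansive_mono[of g 0 1] assms by simp
  next
    case (Suc j)
    have "L_seq d g n0 j + 1 \<le> L_seq d g n0 i + 1" unfolding Suc L_seq.simps by simp
    then show ?thesis
      unfolding Suc N_seq.simps by (intro funpow_expansive_mono assms) (simp add: Suc)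
  qed
qed

text \<open>The \<open>+ 1\<close> counts the all-infinite vector, the only element of
  \<open>thin N 0\<close>.\<close>

lemma card_UN_thin:
  "card (\<Union>m\<le>i. thin (N_seq CARD('n) g n0) m :: ('n::finite \<Rightarrow> enat) set)
    \<le> L_seq CARD('n) g n0 i + 1"
proof (induction i)
  case 0
  then show ?case by simp
next
  case (Suc i)
  let ?T = "\<lambda>m. thin (N_seq CARD('n) g n0) m :: ('n \<Rightarrow> enat) set"
  have "card (\<Union>m\<le>Suc i. ?T m) = card (?T (Suc i) \<union> (\<Union>m\<le>i. ?T m))"
    by (simp add: atMost_Suc del: thin.simps)
  also have "\<dots> \<le> card (?T (Suc i)) + card (\<Union>m\<le>i. ?T m)" by (rule card_Un_le)
  also have "\<dots> \<le> L_seq CARD('n) g n0 (Suc i) + 1"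
    unfolding L_seq.simps
    using Suc.IH card_thin[where N = "N_seq CARD('n) g n0" and m = "Suc i" and 'n = 'n]
    by linarith
  finally show ?case .
qed


subsection \<open>Proper ideals of a descending chain\<close>

lemma descending_chain_antimono:
  assumes "descending_chain D l"
  shows "k \<le> k' \<Longrightarrow> k' \<le> l \<Longrightarrow> D k' \<subseteq> D k"
proof (induction k' rule: dec_induct)
  case (step k')
  then have "D (Suc k') \<subset> D k'" using assms by (simp add: descending_chain_def)
  with step show ?case by auto
qed simp

text \<open>An ideal that has left never returns. If \<open>v\<close> reappeared later, then
  \<open>v \<le> w \<le> u\<close> with \<open>w\<close> from \<open>D (Suc k)\<close> and
  \<open>u\<close> from \<open>D k\<close>; the antichain at \<open>k\<close> forces
  \<open>v = u\<close>, hence \<open>v = w\<close>.\<close>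

lemma proper_at_unique:
  assumes D: "descending_chain D l" and "proper_at D l k v" "proper_at D l k' v"
  shows "k = k'"
proof -
  have no: False if "proper_at D l k v" "proper_at D l k' v" "k < k'" for k k'
  proof -
    have lt: "k < l" "k' < l" using that by (auto simp: proper_at_def)
    have dc: "downward_closed (D j)" if "j \<le> l" for j
      using D that by (simp add: descending_chain_def)
    have "ideal_of v \<subseteq> D k'"
      using that lt by (intro decomposition_subset dc) (auto simp: proper_at_def)
    also have "D k' \<subseteq> D (Suc k)"
      using that lt by (intro descending_chain_antimono[OF D]) auto
    finally obtain w where w: "w \<in> decomposition (D (Suc k))" "v \<le> w"
      using dc[of "Suc k"] lt by (auto elim: ideal_subset_decomposition)
    have "ideal_of w \<subseteq> D (Suc k)" using w lt by (intro decomposition_subset dc) auto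
    also have "D (Suc k) \<subseteq> D k" using lt by (intro descending_chain_antimono[OF D]) auto
    finally obtain u where u: "u \<in> decomposition (D k)" "w \<le> u"
      using dc[of k] lt by (auto elim: ideal_subset_decomposition)
    have "v = u"
      using decomposition_antichain[of "D k" v u] dc[of k] lt that u w order_trans[of v w u]
      by (auto simp: proper_at_def)
    with u w have "v = w" by simp
    with w that show False by (simp add: proper_at_def)
  qed
  show ?thesis using no[of k k'] no[of k' k] assms(2,3) by (meson linorder_neqE_nat)
qed

lemma proper_at_exists:
  assumes D: "descending_chain D l" and k: "k < l"
  obtains v where "proper_at D l k v"
proof -
  have dc: "downward_closed (D k)" "downward_closed (D (Suc k))" "D (Suc k) \<subset> D k"
    using D k by (auto simp: descending_chain_def)
  have "\<not> decomposition (D k) \<subseteq> decomposition (D (Suc k))"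
    using decomposition_Union[OF dc(1)] decomposition_Union[OF dc(2)] dc(3) by blast
  with k that show ?thesis by (auto simp: proper_at_def)
qed

lemma new_ideal_below_proper:
  assumes D: "descending_chain D l" and k: "k < l"
    and w: "w \<in> decomposition (D (Suc k))" "w \<notin> decomposition (D k)"
  obtains v where "proper_at D l k v" "w \<le> v"
proof -
  have dc: "downward_closed (D k)" "downward_closed (D (Suc k))" "D (Suc k) \<subset> D k"
    using D k by (auto simp: descending_chain_def)
  have "ideal_of w \<subseteq> D k" using decomposition_subset[OF dc(2) w(1)] dc(3) by blast
  then obtain v where v: "v \<in> decomposition (D k)" "w \<le> v"
    using dc(1) by (blast elim: ideal_subset_decomposition)
  \<comment> \<open>If \<open>v\<close> survived, the antichain of \<open>D (Suc k)\<close> would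
    give \<open>w = v\<close>, and \<open>w\<close> would not be new.\<close>
  have "v \<notin> decomposition (D (Suc k))"
    using decomposition_antichain[OF dc(2) w(1)] v w by blast
  with v k that show ?thesis by (auto simp: proper_at_def)
qed

section \<open>Counting steps by proper ideals\<close>

lemma strongly_monotone_earlier:
  assumes "strongly_monotone D l"
  shows "k' \<le> k \<Longrightarrow> proper_at D l k v \<Longrightarrow> \<exists>w. proper_at D l k' w \<and> ideal_dim v \<le> ideal_dim w"
proof (induction k arbitrary: v rule: dec_induct)
  case (step k)
  from assms step.prems obtain u where "proper_at D l k u" "ideal_dim v \<le> ideal_dim u"
    unfolding strongly_monotone_def by blast
  with step.IH show ?case by (meson order_trans)
qed blast

text \<open>Thinness is assumed only up to step \<open>k\<close>, so that the induction proving
  thinness can already use this bound.\<close>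

lemma proper_step_bound:
  fixes D :: "nat \<Rightarrow> ('n::finite \<Rightarrow> nat) set"
  assumes D: "descending_chain D l" and sm: "strongly_monotone D l"
    and thin: "\<And>j v. j \<le> k \<Longrightarrow> v \<in> decomposition (D j) \<Longrightarrow>
      v \<in> thin (N_seq CARD('n) g n0) (card (fin_set v))"
    and v: "proper_at D l k v"
  shows "k \<le> L_seq CARD('n) g n0 (card (fin_set v))"
proof -
  let ?i = "card (fin_set v)"
  have "\<forall>j\<in>{..k}. \<exists>w. proper_at D l j w \<and> card (fin_set w) \<le> ?i"
    \<comment> \<open>A larger dimension means fewer finite coordinates.\<close>
    using strongly_monotone_earlier[OF sm _ v] by (auto simp: card_fin_set intro: diff_le_mono2)
  then obtain w where w: "\<And>j. j \<le> k \<Longrightarrow> proper_at D l j (w j)"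
    "\<And>j. j \<le> k \<Longrightarrow> card (fin_set (w j)) \<le> ?i"
    by (metis atMost_iff)
  have "inj_on w {..k}"
  proof (rule inj_onI)
    fix x y assume "x \<in> {..k}" "y \<in> {..k}" "w x = w y"
    then show "x = y" using w(1)[of x] w(1)[of y] by (auto intro: proper_at_unique[OF D])
  qed
  moreover have "w ` {..k} \<subseteq> (\<Union>m\<le>?i. thin (N_seq CARD('n) g n0) m)"
    using w thin by (fastforce simp: proper_at_def)
  ultimately have "card {..k} \<le> card (\<Union>m\<le>?i. thin (N_seq CARD('n) g n0) m :: ('n \<Rightarrow> enat) set)"
    by (rule card_inj_on_le) (simp add: finite_thin)
  also have "\<dots> \<le> L_seq CARD('n) g n0 ?i + 1" by (rule card_UN_thin)
  finally show ?thesis by simp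
qed

lemma controlled_coordinate_le:
  assumes "descending_chain D l" "controlled g n0 D l" "k \<le> l"
    and "v \<in> decomposition (D k)" "v i = enat a"
  shows "a \<le> (g ^^ k) n0"
proof -
  have "a \<le> ideal_norm v" using assms by (simp add: le_ideal_norm)
  also have "\<dots> \<le> set_norm (D k)"
    using assms by (intro ideal_norm_le_set_norm) (auto simp: descending_chain_def)
  also have "\<dots> \<le> (g ^^ k) n0" using assms by (simp add: controlled_def)
  finally show ?thesis .
qed

lemma decomposition_thin:
  fixes D :: "nat \<Rightarrow> ('n::finite \<Rightarrow> nat) set"
  assumes g: "\<And>x. x \<le> g x" and D: "descending_chain D l"
    and c: "controlled g n0 D l" and sm: "strongly_monotone D l"
  shows "k \<le> l \<Longrightarrow> v \<in> decomposition (D k) \<Longrightarrow> v \<in> thin (N_seq CARD('n) g n0) (card (fin_set v))"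
proof (induction k arbitrary: v rule: less_induct)
  case (less k)
  let ?N = "N_seq CARD('n) g n0"
  have N: "mono ?N" using g by (rule mono_N_seq)
  have IH: "u \<in> thin ?N (card (fin_set u))" if "j < k" "u \<in> decomposition (D j)" for j u
    using less.IH[OF that(1) _ that(2)] that(1) less.prems(1) by simp
  note bound = controlled_coordinate_le[OF D c less.prems]
  show ?case
  proof (cases k)
    case 0
    show ?thesis
    \<comment> \<open>At the start the comparison is with the whole space, and the coordinates are
      at most \<open>n0\<close>, which is \<open>N_seq\<close> at 0.\<close>
    proof (rule thin_below[OF N, of "\<lambda>_. \<infinity>" 0])
      fix i a assume "v i = enat a"
      then have "a \<le> ?N 0" using bound 0 by simp
      also have "\<dots> \<le> ?N (Suc 0)" using N by (rule monoD) simp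
      finally show "a \<le> ?N (Suc 0)" .
    qed (auto simp: le_fun_def)
  next
    case (Suc k')
    show ?thesis
    proof (cases "v \<in> decomposition (D k')")
      case True
      then show ?thesis using Suc by (intro IH[of k']) auto
    next
      case False
      obtain u where u: "proper_at D l k' u" "v \<le> u"
        using new_ideal_below_proper[OF D _ _ False] less.prems Suc by auto
      let ?i = "card (fin_set u)"
      have "k' \<le> L_seq CARD('n) g n0 ?i"
        using Suc by (intro proper_step_bound[OF D sm _ u(1)] IH) auto
      \<comment> \<open>The exponent \<open>k = Suc k'\<close> is at most \<open>L_seq\<close> at
        \<open>?i\<close> plus 1, the exponent that defines \<open>N_seq\<close> at
        \<open>Suc ?i\<close>.\<close>
      then have le: "(g ^^ k) n0 \<le> ?N (Suc ?i)"
        unfolding N_seq.simps Suc by (intro funpow_expansive_mono g) simp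
      show ?thesis
      proof (rule thin_below[OF N _ u(2)])
        show "u \<in> thin ?N ?i" using Suc u(1) by (intro IH[of k']) (auto simp: proper_at_def)
        show "a \<le> ?N (Suc ?i)" if "v i = enat a" for i a
          using bound[OF that] le by (rule order_trans)
      qed
    qed
  qed
qed

theorem theorem3p6:
  fixes D :: "nat \<Rightarrow> ('n::finite \<Rightarrow> nat) set"
    and g :: "nat \<Rightarrow> nat"
    and n0 l :: nat
  assumes "mono g"
    and "\<And>x. x \<le> g x"
    and "descending_chain D l"
    and "controlled g n0 D l"
    and "strongly_monotone D l"
  shows "l \<le> L_seq CARD('n) g n0 CARD('n) + 1"
proof (cases l)
  \<comment> \<open>The last strict inclusion yields an ideal proper at step
    \<open>k = l - 1\<close>; this shift is the \<open>+ 1\<close> in the bound.\<close>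
  case (Suc k)
  then obtain v where v: "proper_at D l k v"
    using proper_at_exists[OF assms(3), of k] by auto
  have "k \<le> L_seq CARD('n) g n0 (card (fin_set v))"
    using Suc by (intro proper_step_bound[OF assms(3,5) _ v] decomposition_thin[OF assms(2-5)]) auto
  also have "\<dots> \<le> L_seq CARD('n) g n0 CARD('n)"
  proof (rule lift_Suc_mono_le[of "L_seq CARD('n) g n0"])
    show "card (fin_set v) \<le> CARD('n)" by (rule card_mono) auto
  qed simp
  finally show ?thesis using Suc by simp
qed simp

end
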